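(* Let $A\in\mathbb S_d^g$. If $\mathcal D_A(2)=\overline{\mathcal D_A(2)}$ and the polar dual $\mathcal D_A^\circ$ of $\mathcal D_A$ is again a free spectrahedron, then $\mathcal D_A(1)\subseteq\mathbb R^g$ is a polyhedron. In particular, if $\mathcal D_A(1)$ is a ball, then $\mathcal D_A^\circ$ is not a free spectrahedron.
   Context: $\mathbb S_n^g$ is the set of $g$-tuples of complex self-adjoint $n\times n$ matrices, so $\mathbb S_1^g=\mathbb R^g$. For $A\in\mathbb S_d^g$ and $X\in\mathbb S_n^g$, $L_A(X)=I-\sum_{j=1}^gA_j\otimes X_j$. The free spectrahedron $\mathcal D_A=(\mathcal D_A(n))_n$ is $\mathcal D_A(n)=\{X\in\mathbb S_n^g:L_A(X)\succeq0\}$; a free spectrahedron is any set of this form for some $d$ and some $A\in\mathbb S_d^g$. $\overline{\mathcal D_A(2)}=\{\overline X:X\in\mathcal D_A(2)\}$ where $\overline X$ is the entrywise complex conjugate of the tuple $X$. The free polar dual of $K=(K(n))_n$ is $K^\circ=(K^\circ(n))_n$, $K^\circ(n)=\{B\in\mathbb S_n^g:L_B(X)\succeq0\text{ for all }X\in K(m)\text{ and all }m\}$.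
   Formalization: The claim about balls is stated for g ≥ 2 and under the hypothesis that D_A(2) equals its complex conjugate; for g = 1 it fails, e.g. A = diag(1,-1), where D_A(1) = [-1,1] and D_A is its own polar dual. *)

theory Defs
  imports "HOL-Analysis.Analysis" "Jordan_Normal_Form.Schur_Decomposition"
begin

text \<open>
  The number of variables is \<open>g = CARD('g)\<close>; a tuple of matrices is a function on the finite
  index type \<open>'g\<close>, and a graded set assigns to each level \<open>n\<close> a set of tuples.  Matrix sizes
  and levels are positive integers; the level \<open>0\<close> (empty matrices) carries no meaning and is
  never tested below.
\<close>

type_synonym 'g mat_tuple = "'g \<Rightarrow> complex mat"
type_synonym 'g graded_set = "nat \<Rightarrow> 'g mat_tuple set"

definition self_adjoint :: "nat \<Rightarrow> complex mat \<Rightarrow> bool" where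
  "self_adjoint n M \<longleftrightarrow> M \<in> carrier_mat n n \<and> mat_adjoint M = M"

definition sa_tuples :: "nat \<Rightarrow> 'g::finite mat_tuple set" where
  "sa_tuples n = {X. \<forall>j. self_adjoint n (X j)}"

definition psd :: "nat \<Rightarrow> complex mat \<Rightarrow> bool" where
  "psd n M \<longleftrightarrow> self_adjoint n M \<and> (\<forall>v\<in>carrier_vec n. 0 \<le> Re ((M *\<^sub>v v) \<bullet>c v))"

definition kronecker :: "complex mat \<Rightarrow> complex mat \<Rightarrow> complex mat" (infixl "\<otimes>\<^sub>K" 70) where
  "M \<otimes>\<^sub>K N = mat (dim_row M * dim_row N) (dim_col M * dim_col N)
     (\<lambda>(r, c). index_mat M (r div dim_row N, c div dim_col N) *
               index_mat N (r mod dim_row N, c mod dim_col N))"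

text \<open>
  The carrier-based matrices do not form a type-class monoid, so the sum over \<open>j\<close> in
  \<open>L\<^sub>A(X) = I - (\<Sum>j. A\<^sub>j \<otimes> X\<^sub>j)\<close> is taken entrywise.
\<close>

definition linear_pencil :: "nat \<Rightarrow> nat \<Rightarrow> 'g::finite mat_tuple \<Rightarrow> 'g mat_tuple \<Rightarrow> complex mat" where
  "linear_pencil d n A X =
     1\<^sub>m (d * n) - mat (d * n) (d * n) (\<lambda>rc. \<Sum>j\<in>UNIV. index_mat (A j \<otimes>\<^sub>K X j) rc)"

definition free_spectrahedron :: "nat \<Rightarrow> 'g::finite mat_tuple \<Rightarrow> 'g graded_set" where
  "free_spectrahedron d A n = {X \<in> sa_tuples n. psd (d * n) (linear_pencil d n A X)}"

definition is_free_spectrahedron :: "'g::finite graded_set \<Rightarrow> bool" where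
  "is_free_spectrahedron K \<longleftrightarrow>
     (\<exists>d>0. \<exists>A\<in>sa_tuples d. \<forall>n>0. K n = free_spectrahedron d A n)"

definition conj_tuple :: "'g mat_tuple \<Rightarrow> 'g mat_tuple" where
  "conj_tuple X = (\<lambda>j. map_mat cnj (X j))"

definition polar_dual :: "'g::finite graded_set \<Rightarrow> 'g graded_set" where
  "polar_dual K n =
     {B \<in> sa_tuples n. \<forall>m>0. \<forall>X\<in>K m. psd (n * m) (linear_pencil n m B X)}"

text \<open>The identification of \<open>\<real>\<^sup>g\<close> with the tuples of self-adjoint \<open>1 \<times> 1\<close> matrices.\<close>

definition scalar_tuple :: "real ^ 'g \<Rightarrow> 'g::finite mat_tuple" where
  "scalar_tuple x = (\<lambda>j. mat 1 1 (\<lambda>_. complex_of_real (vec_nth x j)))"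

definition level_one :: "'g::finite graded_set \<Rightarrow> (real ^ 'g) set" where
  "level_one K = {x. scalar_tuple x \<in> K 1}"

lemma bij_betw_scalar_tuple:
  "bij_betw scalar_tuple (UNIV :: (real ^ 'g::finite) set) (sa_tuples 1)"
proof (rule bij_betw_imageI)
  show "inj (scalar_tuple :: real ^ 'g \<Rightarrow> _)"
  proof (rule injI)
    fix x y :: "real ^ 'g"
    assume eq: "scalar_tuple x = scalar_tuple y"
    have "vec_nth x j = vec_nth y j" for j
      using arg_cong[OF fun_cong[OF eq, of j], of "\<lambda>M. index_mat M (0, 0)"]
      by (simp add: scalar_tuple_def)
    then show "x = y" by (simp add: Finite_Cartesian_Product.vec_eq_iff)
  qed
  show "range (scalar_tuple :: real ^ 'g \<Rightarrow> _) = sa_tuples 1"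
  proof (intro equalityI subsetI)
    fix X :: "'g mat_tuple"
    assume "X \<in> range scalar_tuple"
    then show "X \<in> sa_tuples 1"
      by (auto simp: scalar_tuple_def sa_tuples_def self_adjoint_def mat_adjoint_def
          mat_of_rows_def intro!: eq_matI)
  next
    fix X :: "'g mat_tuple"
    assume X: "X \<in> sa_tuples 1"
    have "X = scalar_tuple (vec_lambda (\<lambda>j. Re (index_mat (X j) (0, 0))))"
    proof
      fix j
      from X have c: "X j \<in> carrier_mat 1 1" and a: "mat_adjoint (X j) = X j"
        by (auto simp: sa_tuples_def self_adjoint_def)
      have "cnj (index_mat (X j) (0, 0)) = index_mat (mat_adjoint (X j)) (0, 0)"
        using c by (simp add: mat_adjoint_def mat_of_rows_def)
      then have "Im (index_mat (X j) (0, 0)) = 0"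
        unfolding a by (metis cnj.simps(2) equation_minus_iff neg_equal_zero)
      then show "X j = scalar_tuple (vec_lambda (\<lambda>j. Re (index_mat (X j) (0, 0)))) j"
        using c by (auto simp: scalar_tuple_def complex_eq_iff intro!: eq_matI)
    qed
    then show "X \<in> range scalar_tuple" by blast
  qed
qed

end

theory Submission
  imports Defs "Jordan_Normal_Form.Spectral_Radius"
begin

text \<open>
  Suppose \<open>\<D>\<^sub>A\<degree> = \<D>\<^sub>B\<close>.  Since \<open>A \<in> \<D>\<^sub>A\<degree> = \<D>\<^sub>B\<close>, flipping tensor factors gives \<open>B \<in> \<D>\<^sub>A\<close>, and separation
  at level one shows that \<open>\<D>\<^sub>A(1)\<close> is the convex hull of the compact set of points
  \<open>(\<langle>B\<^sub>j u, u\<rangle>)\<^sub>j\<close> with \<open>u\<close> a unit vector.  So an extreme point \<open>a\<close> is such a point.  Compressing \<open>B\<close>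
  to the span of \<open>u\<close> and a unit vector \<open>w \<bottom> u\<close> gives an element of \<open>\<D>\<^sub>A(2)\<close> with diagonal \<open>(a, \<gamma>)\<close> and
  off-diagonal \<open>\<beta>\<^sub>j = \<langle>B\<^sub>j u, w\<rangle>\<close>.  Combining it with its conjugate replaces \<open>\<beta>\<close> by its real or
  imaginary part \<open>\<eta>\<close>.  Positivity of the resulting block matrix bounds \<open>\<Sum>\<^sub>j \<eta>\<^sub>j A\<^sub>j\<close>, in either sign, by
  a multiple of \<open>L\<^sub>A(a)\<close>, so \<open>a \<plusminus> t\<eta> \<in> \<D>\<^sub>A(1)\<close> for small \<open>t > 0\<close>, and extremality forces \<open>\<eta> = 0\<close>.
  Hence \<open>u\<close> is a joint eigenvector of \<open>B\<close> with eigenvalues \<open>a\<close>, leaving finitely many extreme points.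
\<close>

subsection \<open>Sesquilinear forms and the pencil\<close>

text \<open>Vectors of length \<open>n\<close> are functions on \<open>nat\<close> of which only the
  values below \<open>n\<close> are read. Blocks of a tensor vector are then plain sections
  \<open>v i\<close>, and no carrier conditions arise.\<close>

definition norm_sq :: "nat \<Rightarrow> (nat \<Rightarrow> complex) \<Rightarrow> real" where
  "norm_sq n x = (\<Sum>i<n. (cmod (x i))\<^sup>2)"

definition sesq :: "nat \<Rightarrow> complex mat \<Rightarrow> (nat \<Rightarrow> complex) \<Rightarrow> (nat \<Rightarrow> complex) \<Rightarrow> complex" where
  "sesq n M x y = (\<Sum>i<n. (\<Sum>k<n. index_mat M (i, k) * x k) * cnj (y i))"

text \<open>The point of the joint numerical range that belongs to \<open>u\<close>. For
  self-adjoint tuples the forms are real, so \<open>Re\<close> only changes the type.\<close>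

definition num_point :: "nat \<Rightarrow> 'g::finite mat_tuple \<Rightarrow> (nat \<Rightarrow> complex) \<Rightarrow> real ^ 'g" where
  "num_point n X u = (\<chi> j. Re (sesq n (X j) u u))"

text \<open>The quadratic form of \<open>L_A(X)\<close> at the sum of the tensors of the
  \<open>i\<close>-th basis vector with the block \<open>v i\<close>.\<close>

definition pencil_form ::
    "nat \<Rightarrow> nat \<Rightarrow> 'g::finite mat_tuple \<Rightarrow> 'g mat_tuple \<Rightarrow> (nat \<Rightarrow> nat \<Rightarrow> complex) \<Rightarrow> real" where
  "pencil_form d n A X v = (\<Sum>i<d. norm_sq n (v i)) -
     Re (\<Sum>j\<in>UNIV. \<Sum>i<d. \<Sum>k<d. index_mat (A j) (i, k) * sesq n (X j) (v k) (v i))"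

lemma self_adjoint_iff:
  "self_adjoint n M \<longleftrightarrow> M \<in> carrier_mat n n \<and>
     (\<forall>i<n. \<forall>k<n. index_mat M (k, i) = cnj (index_mat M (i, k)))"
proof (cases "M \<in> carrier_mat n n")
  case True
  have entry: "index_mat (mat_adjoint M) (k, i) = cnj (index_mat M (i, k))" if "i < n" "k < n" for i k
    using True that by (simp add: mat_adjoint_def mat_of_rows_def)
  have dims: "dim_row (mat_adjoint M) = n" "dim_col (mat_adjoint M) = n" "dim_row M = n" "dim_col M = n"
    using True by (auto simp: mat_adjoint_def mat_of_rows_def)
  have "mat_adjoint M = M \<longleftrightarrow> (\<forall>i<n. \<forall>k<n. index_mat (mat_adjoint M) (k, i) = index_mat M (k, i))"
    by (auto simp: mat_eq_iff dims)
  also have "\<dots> \<longleftrightarrow> (\<forall>i<n. \<forall>k<n. index_mat M (k, i) = cnj (index_mat M (i, k)))"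
    using entry by metis
  finally show ?thesis using True unfolding self_adjoint_def by blast
qed (simp add: self_adjoint_def)

lemma sa_tuples_iff:
  "X \<in> sa_tuples n \<longleftrightarrow> (\<forall>j. X j \<in> carrier_mat n n \<and>
     (\<forall>i<n. \<forall>k<n. index_mat (X j) (k, i) = cnj (index_mat (X j) (i, k))))"
  by (simp add: sa_tuples_def self_adjoint_iff)

lemma norm_sq_nonneg [simp]: "0 \<le> norm_sq n x"
  by (simp add: norm_sq_def sum_nonneg)

lemma norm_sq_scale: "norm_sq n (\<lambda>i. c * x i) = (cmod c)\<^sup>2 * norm_sq n x"
  by (simp add: norm_sq_def norm_mult power_mult_distrib sum_distrib_left)

lemma norm_sq_eq_0_iff: "norm_sq n x = 0 \<longleftrightarrow> (\<forall>i<n. x i = 0)"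
  by (auto simp: norm_sq_def sum_nonneg_eq_0_iff)

lemma norm_sq_coord_le: "i < n \<Longrightarrow> (cmod (x i))\<^sup>2 \<le> norm_sq n x"
  unfolding norm_sq_def by (rule member_le_sum) auto

lemma sesq_scale: "sesq n M (\<lambda>i. a * x i) (\<lambda>i. b * y i) = a * cnj b * sesq n M x y"
  by (simp add: sesq_def sum_distrib_left sum_distrib_right algebra_simps)

lemma sesq_sum:
  "sesq n M (\<lambda>i. \<Sum>t\<in>T. a t * w t i) (\<lambda>i. \<Sum>s\<in>S. b s * z s i) =
     (\<Sum>t\<in>T. \<Sum>s\<in>S. a t * cnj (b s) * sesq n M (w t) (z s))"
proof -
  have "sesq n M (\<lambda>i. \<Sum>t\<in>T. a t * w t i) y = (\<Sum>t\<in>T. a t * sesq n M (w t) y)" for y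
  proof -
    have "(\<Sum>k<n. index_mat M (i, k) * (\<Sum>t\<in>T. a t * w t k)) * cnj (y i) =
        (\<Sum>t\<in>T. a t * ((\<Sum>k<n. index_mat M (i, k) * w t k) * cnj (y i)))" for i
    proof -
      have "(\<Sum>k<n. index_mat M (i, k) * (\<Sum>t\<in>T. a t * w t k)) =
          (\<Sum>t\<in>T. a t * (\<Sum>k<n. index_mat M (i, k) * w t k))"
        unfolding sum_distrib_left by (subst sum.swap) (simp add: mult.left_commute)
      then show ?thesis by (simp add: sum_distrib_right mult.assoc)
    qed
    then show ?thesis
      by (simp add: sesq_def sum_distrib_left sum.swap[of _ T])
  qed
  moreover have "sesq n M x (\<lambda>i. \<Sum>s\<in>S. b s * z s i) = (\<Sum>s\<in>S. cnj (b s) * sesq n M x (z s))" for x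
    by (simp add: sesq_def sum_distrib_left sum.swap[of _ S] algebra_simps)
  ultimately show ?thesis
    by (simp add: sum_distrib_left mult.assoc)
qed

lemma sesq_cnj:
  assumes "self_adjoint n M"
  shows "sesq n M y x = cnj (sesq n M x y)"
proof -
  have "cnj (sesq n M x y) = (\<Sum>i<n. \<Sum>k<n. cnj (index_mat M (i, k)) * cnj (x k) * y i)"
    by (simp add: sesq_def sum_distrib_right)
  also have "\<dots> = (\<Sum>i<n. \<Sum>k<n. index_mat M (k, i) * cnj (x k) * y i)"
  proof -
    have "cnj (index_mat M (i, k)) = index_mat M (k, i)" if "i < n" "k < n" for i k
      using assms that unfolding self_adjoint_iff by metis
    then show ?thesis by (simp cong: sum.cong_simp)
  qed
  also have "\<dots> = (\<Sum>k<n. \<Sum>i<n. index_mat M (k, i) * cnj (x k) * y i)"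
    by (rule sum.swap)
  also have "\<dots> = sesq n M y x"
    by (simp add: sesq_def sum_distrib_left sum_distrib_right mult_ac)
  finally show ?thesis by simp
qed

lemma sesq_real:
  assumes "self_adjoint n M"
  shows "sesq n M x x = of_real (Re (sesq n M x x))"
  using sesq_cnj[OF assms, of x x] by (metis Reals_cnj_iff of_real_Re)

lemma num_point_scale: "num_point n X (\<lambda>i. c * u i) = (cmod c)\<^sup>2 *\<^sub>R num_point n X u"
proof -
  have "Re (c * cnj c * s) = (cmod c)\<^sup>2 * Re s" for s
    by (simp flip: complex_norm_square)
  then show ?thesis
    by (simp add: num_point_def sesq_scale Finite_Cartesian_Product.vec_eq_iff)
qed

lemma sum_lessThan_mult:
  fixes f :: "nat \<Rightarrow> 'a::comm_monoid_add"
  shows "(\<Sum>r<d * n. f r) = (\<Sum>i<d. \<Sum>p<n. f (i * n + p))"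
proof -
  have "(\<Sum>r\<in>{i * n..<i * n + n}. f r) = (\<Sum>p<n. f (i * n + p))" for i
    using sum.shift_bounds_nat_ivl[of f 0 "i * n" n]
    by (simp add: lessThan_atLeast0 add.commute)
  then show ?thesis by (simp flip: sum.nat_group)
qed

lemma flat_index_less:
  fixes i p d n :: nat
  assumes "i < d" "p < n"
  shows "i * n + p < d * n"
proof -
  have "i * n + p < Suc i * n" using assms by simp
  also have "\<dots> \<le> d * n" using assms by (intro mult_le_mono1) simp
  finally show ?thesis .
qed

lemma index_linear_pencil:
  assumes "A \<in> sa_tuples d" "X \<in> sa_tuples n" "i < d" "k < d" "p < n" "q < n"
  shows "index_mat (linear_pencil d n A X) (i * n + p, k * n + q) =
    (if i = k \<and> p = q then 1 else 0) -
    (\<Sum>j\<in>UNIV. index_mat (A j) (i, k) * index_mat (X j) (p, q))"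
proof -
  have c: "dim_row (A j) = d" "dim_col (A j) = d" "dim_row (X j) = n" "dim_col (X j) = n" for j
    using assms by (auto simp: sa_tuples_iff)
  have lt: "i * n + p < d * n" "k * n + q < d * n"
    using assms by (simp_all add: flat_index_less)
  have eq: "i * n + p = k * n + q \<longleftrightarrow> i = k \<and> p = q"
  proof
    assume eq: "i * n + p = k * n + q"
    have "(i * n + p) div n = i" "(k * n + q) div n = k" using assms by simp_all
    with eq have "i = k" by metis
    with eq show "i = k \<and> p = q" by simp
  qed simp
  show ?thesis
    using lt assms(3-) by (simp add: linear_pencil_def kronecker_def c eq)
qed

text \<open>The flat index \<open>i * n + p\<close> cuts a vector of length \<open>d * n\<close>
  into \<open>d\<close> blocks of length \<open>n\<close>. The identity contributes the block norms,
  each Kronecker product a double sum over blocks.\<close>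

lemma psd_linear_pencil_iff:
  fixes A X :: "'g::finite mat_tuple"
  assumes A: "A \<in> sa_tuples d" and X: "X \<in> sa_tuples n"
  shows "psd (d * n) (linear_pencil d n A X) \<longleftrightarrow> (\<forall>v. 0 \<le> pencil_form d n A X v)"
proof -
  let ?L = "linear_pencil d n A X"
  have carr: "?L \<in> carrier_mat (d * n) (d * n)"
    unfolding linear_pencil_def by (rule minus_carrier_mat) simp
  have decomp: "\<exists>i<d. \<exists>p<n. r = i * n + p" if "r < d * n" for r
  proof -
    have "n > 0" using that by (cases n) auto
    moreover have "r div n < d" using that by (simp add: less_mult_imp_div_less)
    ultimately show ?thesis by (metis div_mult_mod_eq mod_less_divisor)
  qed
  have sa: "self_adjoint (d * n) ?L"
    unfolding self_adjoint_iff
  proof (intro conjI carr allI impI)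
    fix r s assume "r < d * n" "s < d * n"
    then obtain i p k q where *: "i < d" "p < n" "k < d" "q < n"
      and rs: "r = i * n + p" "s = k * n + q" using decomp by meson
    have "index_mat (A j) (k, i) = cnj (index_mat (A j) (i, k))"
      "index_mat (X j) (q, p) = cnj (index_mat (X j) (p, q))" for j
      using A X * unfolding sa_tuples_iff by blast+
    then have "(\<Sum>j\<in>UNIV. index_mat (A j) (k, i) * index_mat (X j) (q, p)) =
        cnj (\<Sum>j\<in>UNIV. index_mat (A j) (i, k) * index_mat (X j) (p, q))"
      by simp
    moreover have "k = i \<and> q = p \<longleftrightarrow> i = k \<and> p = q" by blast
    ultimately show "index_mat ?L (s, r) = cnj (index_mat ?L (r, s))"
      unfolding rs index_linear_pencil[OF A X *(3,1,4,2)] index_linear_pencil[OF A X *(1,3,2,4)]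
      by simp
  qed
  have form: "Re ((?L *\<^sub>v w) \<bullet>c w) = pencil_form d n A X v"
    if w: "w \<in> carrier_vec (d * n)" and vw: "\<And>i p. i < d \<Longrightarrow> p < n \<Longrightarrow> vec_index w (i * n + p) = v i p"
    for v w
  proof -
    have "(?L *\<^sub>v w) \<bullet>c w = (\<Sum>r<d * n. (\<Sum>s<d * n. index_mat ?L (r, s) * vec_index w s) * cnj (vec_index w r))"
    proof -
      have "vec_index (?L *\<^sub>v w) r = (\<Sum>s<d * n. index_mat ?L (r, s) * vec_index w s)"
        if "r < d * n" for r
        using w carr that by (simp add: scalar_prod_def atLeast0LessThan)
      then show ?thesis
        using w carr by (simp add: scalar_prod_def atLeast0LessThan)
    qed
    also have "\<dots> = (\<Sum>i<d. \<Sum>p<n. (\<Sum>k<d. \<Sum>q<n. ((if i = k \<and> p = q then 1 else 0) -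
        (\<Sum>j\<in>UNIV. index_mat (A j) (i, k) * index_mat (X j) (p, q))) * v k q) * cnj (v i p))"
      unfolding sum_lessThan_mult
      by (simp add: index_linear_pencil[OF A X] vw cong: sum.cong_simp)
    also have "\<dots> = (\<Sum>i<d. \<Sum>p<n. (\<Sum>k<d. \<Sum>q<n. (if i = k \<and> p = q then 1 else 0) * v k q) * cnj (v i p)) -
        (\<Sum>i<d. \<Sum>p<n. (\<Sum>k<d. \<Sum>q<n. (\<Sum>j\<in>UNIV. index_mat (A j) (i, k) * index_mat (X j) (p, q)) * v k q) * cnj (v i p))"
      by (simp add: left_diff_distrib sum_subtractf)
    also have "(\<Sum>i<d. \<Sum>p<n. (\<Sum>k<d. \<Sum>q<n. (if i = k \<and> p = q then 1 else 0) * v k q) * cnj (v i p)) =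
        of_real (\<Sum>i<d. norm_sq n (v i))"
    proof -
      have "(\<Sum>k<d. \<Sum>q<n. (if i = k \<and> p = q then 1 else 0) * v k q) = v i p" if "i < d" "p < n" for i p
      proof -
        have "(if i = k \<and> p = q then 1 else 0) * v k q = (if q = p then if k = i then v k q else 0 else 0)" for k q
          by auto
        then have "(\<Sum>k<d. \<Sum>q<n. (if i = k \<and> p = q then 1 else 0) * v k q) =
            (\<Sum>k<d. \<Sum>q<n. if q = p then if k = i then v k q else 0 else 0)"
          by presburger
        also have "\<dots> = v i p" using that by simp
        finally show ?thesis .
      qed
      then show ?thesis by (simp add: norm_sq_def flip: complex_norm_square)
    qed
    also have "(\<Sum>i<d. \<Sum>p<n. (\<Sum>k<d. \<Sum>q<n. (\<Sum>j\<in>UNIV. index_mat (A j) (i, k) * index_mat (X j) (p, q)) * v k q) * cnj (v i p)) =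
       (\<Sum>i<d. \<Sum>p<n. \<Sum>k<d. \<Sum>q<n. \<Sum>j\<in>UNIV. index_mat (A j) (i, k) * index_mat (X j) (p, q) * v k q * cnj (v i p))"
      by (simp add: sum_distrib_right)
    also have "\<dots> = (\<Sum>i<d. \<Sum>k<d. \<Sum>p<n. \<Sum>q<n. \<Sum>j\<in>UNIV. index_mat (A j) (i, k) * index_mat (X j) (p, q) * v k q * cnj (v i p))"
      by (rule sum.cong[OF refl], rule sum.swap)
    also have "\<dots> = (\<Sum>j\<in>UNIV. \<Sum>i<d. \<Sum>k<d. \<Sum>p<n. \<Sum>q<n. index_mat (A j) (i, k) * index_mat (X j) (p, q) * v k q * cnj (v i p))"
      by (simp only: sum.swap[of _ "UNIV :: 'g set"])
    also have "\<dots> = (\<Sum>j\<in>UNIV. \<Sum>i<d. \<Sum>k<d. index_mat (A j) (i, k) * sesq n (X j) (v k) (v i))"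
      by (simp add: sesq_def sum_distrib_left sum_distrib_right mult.assoc)
    finally show ?thesis by (simp add: pencil_form_def)
  qed
  show ?thesis
  proof
    assume psd: "psd (d * n) ?L"
    show "\<forall>v. 0 \<le> pencil_form d n A X v"
    proof
      fix v :: "nat \<Rightarrow> nat \<Rightarrow> complex"
      let ?w = "Matrix.vec (d * n) (\<lambda>r. v (r div n) (r mod n))"
      have "vec_index ?w (i * n + p) = v i p" if "i < d" "p < n" for i p
        using that by (simp add: flat_index_less)
      then have "Re ((?L *\<^sub>v ?w) \<bullet>c ?w) = pencil_form d n A X v"
        by (intro form) auto
      with psd show "0 \<le> pencil_form d n A X v"
        by (metis psd_def vec_carrier)
    qed
  next
    assume pos: "\<forall>v. 0 \<le> pencil_form d n A X v"
    show "psd (d * n) ?L"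
      unfolding psd_def
    proof (intro conjI sa ballI)
      fix w :: "complex Matrix.vec" assume "w \<in> carrier_vec (d * n)"
      from form[OF this, of "\<lambda>i p. vec_index w (i * n + p)"] pos
      show "0 \<le> Re ((?L *\<^sub>v w) \<bullet>c w)" by simp
    qed
  qed
qed

text \<open>Both sides are the same fourfold sum with block index and inner index exchanged. Hence
  positivity of \<open>L_A(X)\<close> and of \<open>L_X(A)\<close> is one condition.\<close>

lemma pencil_form_flip: "pencil_form n d X A (\<lambda>p i. v i p) = pencil_form d n A X v"
proof -
  have "(\<Sum>p<n. \<Sum>q<n. index_mat (X j) (p, q) * sesq d (A j) (\<lambda>i. v i q) (\<lambda>i. v i p)) =
      (\<Sum>i<d. \<Sum>k<d. index_mat (A j) (i, k) * sesq n (X j) (v k) (v i))" for j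
  proof -
    have "(\<Sum>p<n. \<Sum>q<n. index_mat (X j) (p, q) * sesq d (A j) (\<lambda>i. v i q) (\<lambda>i. v i p)) =
      (\<Sum>p<n. \<Sum>q<n. \<Sum>i<d. \<Sum>k<d. index_mat (X j) (p, q) * index_mat (A j) (i, k) * v k q * cnj (v i p))"
      by (simp add: sesq_def sum_distrib_left sum_distrib_right mult.assoc)
    also have "\<dots> = (\<Sum>i<d. \<Sum>k<d. \<Sum>p<n. \<Sum>q<n. index_mat (X j) (p, q) * index_mat (A j) (i, k) * v k q * cnj (v i p))"
      by (simp only: sum.swap[of _ "{..<d}" "{..<n}"])
    finally show ?thesis
      by (simp add: sesq_def sum_distrib_left sum_distrib_right algebra_simps)
  qed
  moreover have "(\<Sum>p<n. norm_sq d (\<lambda>i. v i p)) = (\<Sum>i<d. norm_sq n (v i))"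
    unfolding norm_sq_def by (rule sum.swap)
  ultimately show ?thesis by (simp add: pencil_form_def)
qed

section \<open>Membership in a free spectrahedron and its level one\<close>

lemma free_spectrahedron_iff:
  assumes "A \<in> sa_tuples d"
  shows "X \<in> free_spectrahedron d A n \<longleftrightarrow>
    X \<in> sa_tuples n \<and> (\<forall>v. 0 \<le> pencil_form d n A X v)"
  using assms by (auto simp: free_spectrahedron_def psd_linear_pencil_iff)

text \<open>On an elementary tensor the form factorises and so pairs the numerical ranges of
  \<open>A\<close> and \<open>X\<close>. The real part is multiplicative here because forms of
  self-adjoint matrices are real.\<close>

lemma pencil_form_tensor:
  assumes A: "A \<in> sa_tuples d" and X: "X \<in> sa_tuples n"
  shows "pencil_form d n A X (\<lambda>i p. x i * u p) =
    norm_sq d x * norm_sq n u - inner (num_point d A x) (num_point n X u)"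
proof -
  have sc: "(\<Sum>i<d. \<Sum>k<d. index_mat (A j) (i, k) * sesq n (X j) (\<lambda>p. x k * u p) (\<lambda>p. x i * u p)) =
      sesq d (A j) x x * sesq n (X j) u u" for j
  proof -
    have "sesq n (X j) (\<lambda>p. x k * u p) (\<lambda>p. x i * u p) = x k * cnj (x i) * sesq n (X j) u u" for i k
      by (rule sesq_scale)
    then show ?thesis
      by (simp add: sesq_def[of d] sum_distrib_left sum_distrib_right mult_ac)
  qed
  have "Re (sesq d (A j) x x * sesq n (X j) u u) =
      Re (sesq d (A j) x x) * Re (sesq n (X j) u u)" for j
  proof -
    have "self_adjoint d (A j)" "self_adjoint n (X j)"
      using A X by (auto simp: sa_tuples_def)
    then have "Im (sesq d (A j) x x) = 0"
      by (metis Im_complex_of_real sesq_real)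
    then show ?thesis by simp
  qed
  then show ?thesis
    unfolding pencil_form_def sc
    by (simp add: norm_sq_scale inner_vec_def num_point_def norm_sq_def[of d] sum_distrib_right
        del: times_complex.simps)
qed

lemma num_point_scalar_tuple:
  "num_point 1 (scalar_tuple x) u = (cmod (u 0))\<^sup>2 *\<^sub>R x"
  by (simp add: num_point_def sesq_def scalar_tuple_def Finite_Cartesian_Product.vec_eq_iff
      mult.assoc flip: complex_norm_square)

lemma scalar_tuple_sa: "scalar_tuple x \<in> sa_tuples 1"
  using bij_betw_scalar_tuple by (auto simp: bij_betw_def)

text \<open>At size one every vector is an elementary tensor with second factor 1.\<close>

lemma pencil_form_scalar:
  assumes "A \<in> sa_tuples d"
  shows "pencil_form d 1 A (scalar_tuple x) v =
    norm_sq d (\<lambda>i. v i 0) - inner x (num_point d A (\<lambda>i. v i 0))"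
proof -
  have "pencil_form d 1 A (scalar_tuple x) v = pencil_form d 1 A (scalar_tuple x) (\<lambda>i p. v i 0 * 1)"
    by (simp add: pencil_form_def sesq_def norm_sq_def)
  also have "\<dots> = norm_sq d (\<lambda>i. v i 0) - inner x (num_point d A (\<lambda>i. v i 0))"
    unfolding pencil_form_tensor[OF assms scalar_tuple_sa] num_point_scalar_tuple
    by (simp add: norm_sq_def inner_commute)
  finally show ?thesis .
qed

lemma level_one_iff:
  assumes "A \<in> sa_tuples d"
  shows "x \<in> level_one (free_spectrahedron d A) \<longleftrightarrow>
    (\<forall>u. inner x (num_point d A u) \<le> norm_sq d u)"
proof -
  have "x \<in> level_one (free_spectrahedron d A) \<longleftrightarrow>
      (\<forall>v. inner x (num_point d A (\<lambda>i. v i (0::nat))) \<le> norm_sq d (\<lambda>i. v i 0))"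
    by (simp add: level_one_def free_spectrahedron_iff[OF assms] pencil_form_scalar[OF assms]
        scalar_tuple_sa del: One_nat_def)
  also have "\<dots> \<longleftrightarrow> (\<forall>u. inner x (num_point d A u) \<le> norm_sq d u)"
    by (auto dest: spec[of _ "\<lambda>i _. _ i"])
  finally show ?thesis .
qed

text \<open>This is compression to the line through \<open>u\<close>: testing on tensors
  \<open>x \<otimes> u\<close> turns the form at \<open>X\<close> into the scalar form at the
  compressed point.\<close>

lemma num_point_mem_level_one:
  assumes A: "A \<in> sa_tuples d" and X: "X \<in> free_spectrahedron d A n" and u: "norm_sq n u = 1"
  shows "num_point n X u \<in> level_one (free_spectrahedron d A)"
  unfolding level_one_iff[OF A]
proof
  fix x
  have "X \<in> sa_tuples n" "0 \<le> pencil_form d n A X (\<lambda>i p. x i * u p)"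
    using X by (simp_all add: free_spectrahedron_iff[OF A])
  then show "inner (num_point n X u) (num_point d A x) \<le> norm_sq d x"
    using u by (simp add: pencil_form_tensor[OF A] inner_commute)
qed

lemma convex_level_one:
  assumes "A \<in> sa_tuples d"
  shows "convex (level_one (free_spectrahedron d A))"
proof (rule convexI)
  fix x y and s t :: real
  assume "x \<in> level_one (free_spectrahedron d A)" "y \<in> level_one (free_spectrahedron d A)"
    and st: "0 \<le> s" "0 \<le> t" "s + t = 1"
  then have "s * inner x (num_point d A u) + t * inner y (num_point d A u) \<le>
      s * norm_sq d u + t * norm_sq d u" for u
    by (intro add_mono mult_left_mono) (auto simp: level_one_iff[OF assms])
  moreover have "s * norm_sq d u + t * norm_sq d u = norm_sq d u" for u
    using st by (metis distrib_right mult_1)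
  ultimately show "s *\<^sub>R x + t *\<^sub>R y \<in> level_one (free_spectrahedron d A)"
    by (simp add: level_one_iff[OF assms] inner_add_left)
qed

lemma sesq_bounded: "cmod (sesq n M x x) \<le> (\<Sum>i<n. \<Sum>k<n. cmod (index_mat M (i, k))) * norm_sq n x"
proof -
  have "cmod (x k * cnj (x i)) \<le> norm_sq n x" if "i < n" "k < n" for i k
  proof -
    have "2 * (cmod (x k) * cmod (x i)) \<le> (cmod (x k))\<^sup>2 + (cmod (x i))\<^sup>2"
      using sum_squares_bound[of "cmod (x k)" "cmod (x i)"] by simp
    then show ?thesis
      using norm_sq_coord_le[OF that(1), of x] norm_sq_coord_le[OF that(2), of x]
      by (simp add: norm_mult)
  qed
  then have "cmod (index_mat M (i, k)) * cmod (x k * cnj (x i)) \<le> cmod (index_mat M (i, k)) * norm_sq n x"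
    if "i < n" "k < n" for i k
    using that by (intro mult_left_mono) auto
  then have "(\<Sum>i<n. \<Sum>k<n. cmod (index_mat M (i, k) * x k * cnj (x i))) \<le>
      (\<Sum>i<n. \<Sum>k<n. cmod (index_mat M (i, k)) * norm_sq n x)"
    by (intro sum_mono) (simp add: norm_mult mult.assoc)
  moreover have "cmod (sesq n M x x) \<le> (\<Sum>i<n. \<Sum>k<n. cmod (index_mat M (i, k) * x k * cnj (x i)))"
    unfolding sesq_def sum_distrib_right by (intro order.trans[OF norm_sum] sum_mono norm_sum)
  ultimately show ?thesis by (simp add: sum_distrib_right)
qed

lemma num_point_bounded:
  fixes X :: "'g::finite mat_tuple"
  obtains C where "C > 0" "\<And>u. norm (num_point n X u) \<le> C * norm_sq n u"
proof
  let ?c = "\<lambda>j. \<Sum>i<n. \<Sum>k<n. cmod (index_mat (X j) (i, k))"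
  \<comment> \<open>The summand 1 keeps the constant positive even if all entries vanish.\<close>
  show "norm (num_point n X u) \<le> (1 + (\<Sum>j\<in>UNIV. ?c j)) * norm_sq n u" for u
  proof -
    have "\<bar>vec_nth (num_point n X u) j\<bar> \<le> ?c j * norm_sq n u" for j
      using sesq_bounded[of n "X j" u] abs_Re_le_cmod[of "sesq n (X j) u u"]
      by (simp add: num_point_def)
    then have "norm (num_point n X u) \<le> (\<Sum>j\<in>UNIV. ?c j * norm_sq n u)"
      by (intro order_trans[OF norm_le_l1_cart] sum_mono)
    also have "\<dots> \<le> (1 + (\<Sum>j\<in>UNIV. ?c j)) * norm_sq n u"
      by (simp add: distrib_right flip: sum_distrib_right)
    finally show ?thesis .
  qed
  show "1 + (\<Sum>j\<in>UNIV. ?c j) > 0"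
    by (intro add_pos_nonneg sum_nonneg) auto
qed

subsection \<open>Compactness of the numerical range\<close>

lemma continuous_on_norm_sq [continuous_intros]:
  assumes "\<And>i. continuous_on S (\<lambda>x. f x i)"
  shows "continuous_on S (\<lambda>x. norm_sq n (f x))"
  unfolding norm_sq_def by (intro continuous_intros assms)

lemma continuous_on_coord [continuous_intros]:
  "continuous_on S (\<lambda>x. x i :: 'b::topological_space)"
  by (rule continuous_on_subset[OF continuous_on_product_coordinates]) simp

lemma continuous_on_num_point:
  "continuous_on S (num_point n X)"
  unfolding num_point_def sesq_def by (intro continuous_intros)

text \<open>Coordinates from \<open>n\<close> on are pinned to 0, so the set is a closed part of a
  product of closed discs and single points, which is compact by Tychonoff.\<close>

lemma compact_norm_sq_le:
  "compact {x :: nat \<Rightarrow> complex. (\<forall>i\<ge>n. x i = 0) \<and> norm_sq n x \<le> r}"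
proof -
  let ?S = "{x :: nat \<Rightarrow> complex. (\<forall>i\<ge>n. x i = 0) \<and> norm_sq n x \<le> r}"
  let ?B = "\<lambda>i. if i < n then cball 0 (sqrt r) else {0 :: complex}"
  have "compactin (product_topology (\<lambda>_. euclidean) UNIV) (PiE UNIV ?B)"
    unfolding compactin_PiE by simp
  then have "compact (PiE UNIV ?B)"
    by (simp add: euclidean_product_topology)
  moreover have "closed {x :: nat \<Rightarrow> complex. norm_sq n x \<le> r}"
    by (intro closed_Collect_le continuous_intros)
  moreover have "?S = PiE UNIV ?B \<inter> {x. norm_sq n x \<le> r}"
  proof -
    have "cmod (x i) \<le> sqrt r" if "norm_sq n x \<le> r" "i < n" for x i
      using norm_sq_coord_le[OF that(2), of x] that(1) by (intro real_le_rsqrt) linarith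
    then show ?thesis by (auto simp: PiE_UNIV_domain split: if_splits)
  qed
  ultimately show ?thesis by (simp add: compact_Int_closed)
qed

lemma compact_norm_sq_eq:
  "compact {x :: nat \<Rightarrow> complex. (\<forall>i\<ge>n. x i = 0) \<and> norm_sq n x = r}"
proof -
  have "{x :: nat \<Rightarrow> complex. (\<forall>i\<ge>n. x i = 0) \<and> norm_sq n x = r} =
      {x. (\<forall>i\<ge>n. x i = 0) \<and> norm_sq n x \<le> r} \<inter> {x. norm_sq n x = r}"
    by auto
  moreover have "closed {x :: nat \<Rightarrow> complex. norm_sq n x = r}"
    by (intro closed_Collect_eq continuous_intros)
  ultimately show ?thesis by (simp add: compact_Int_closed compact_norm_sq_le)
qed

definition numerical_range :: "nat \<Rightarrow> 'g::finite mat_tuple \<Rightarrow> (real ^ 'g) set" where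
  "numerical_range n X = {num_point n X u |u. norm_sq n u = 1}"

lemma compact_numerical_range: "compact (numerical_range n X)"
proof -
  let ?S = "{x :: nat \<Rightarrow> complex. (\<forall>i\<ge>n. x i = 0) \<and> norm_sq n x = 1}"
  have "num_point n X u \<in> num_point n X ` ?S" if "norm_sq n u = 1" for u
  proof (rule image_eqI)
    \<comment> \<open>Cutting \<open>u\<close> off at \<open>n\<close> changes no value that is read
      and moves it into the compact sphere.\<close>
    let ?u = "\<lambda>i. if i < n then u i else 0"
    show "num_point n X u = num_point n X ?u"
      by (simp add: num_point_def sesq_def cong: sum.cong_simp)
    show "?u \<in> ?S"
      using that by (simp add: norm_sq_def cong: sum.cong_simp)
  qed
  then have "numerical_range n X = num_point n X ` ?S"
    by (auto simp: numerical_range_def)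
  then show ?thesis
    by (simp add: compact_continuous_image continuous_on_num_point compact_norm_sq_eq)
qed

section \<open>Minimal-norm preimages under a matrix\<close>

text \<open>The value 0 from \<open>n\<close> on makes equality of images an equality of functions,
  so kernel and fibres need no restriction of indices.\<close>

definition mat_act :: "nat \<Rightarrow> complex mat \<Rightarrow> (nat \<Rightarrow> complex) \<Rightarrow> nat \<Rightarrow> complex" where
  "mat_act n M x i = (if i < n then \<Sum>k<n. index_mat M (i, k) * x k else 0)"

lemma sesq_mat_act: "sesq n M x y = (\<Sum>i<n. mat_act n M x i * cnj (y i))"
  by (simp add: sesq_def mat_act_def)

lemma mat_act_scale: "mat_act n M (\<lambda>i. c * x i) = (\<lambda>i. c * mat_act n M x i)"
  by (auto simp: mat_act_def sum_distrib_left mult_ac)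

lemma mat_act_add: "mat_act n M (\<lambda>i. x i + y i) = (\<lambda>i. mat_act n M x i + mat_act n M y i)"
  by (auto simp: mat_act_def distrib_left sum.distrib)

lemma continuous_on_mat_act [continuous_intros]: "continuous_on S (\<lambda>x. mat_act n M x i)"
  unfolding mat_act_def by (cases "i < n") (auto intro!: continuous_intros)

text \<open>A preimage of minimal norm is bounded by a multiple of the image: unit vectors of minimal norm
  in their coset modulo the kernel form a compact set on which \<open>M\<close> does not vanish.\<close>

lemma bounded_preimage:
  obtains \<delta> where "\<delta> > 0"
    "\<And>x. \<exists>y. mat_act n M y = mat_act n M x \<and> \<delta> * norm_sq n y \<le> norm_sq n (mat_act n M x)"
proof -
  define U where "U = {x :: nat \<Rightarrow> complex. (\<forall>i\<ge>n. x i = 0) \<and> norm_sq n x = 1} \<inter>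
    (\<Inter>z\<in>{z. mat_act n M z = (\<lambda>_. 0)}. {x. 1 \<le> norm_sq n (\<lambda>i. x i + z i)})"
  have "compact U"
    unfolding U_def
    by (intro compact_Int_closed compact_norm_sq_eq closed_INT ballI closed_Collect_le continuous_intros)
  have pos: "norm_sq n (mat_act n M x) > 0" if "x \<in> U" for x
  proof (rule ccontr)
    assume "\<not> norm_sq n (mat_act n M x) > 0"
    then have "norm_sq n (mat_act n M x) = 0" by (simp add: order_antisym)
    then have "mat_act n M x = (\<lambda>_. 0)"
      by (auto simp: norm_sq_eq_0_iff fun_eq_iff mat_act_def)
    \<comment> \<open>Now \<open>- x\<close> lies in the kernel, and adding it to \<open>x\<close>
      gives norm 0, against the minimality of \<open>x\<close> in its coset.\<close>
    then have "mat_act n M (\<lambda>i. - 1 * x i) = (\<lambda>_. 0)"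
      unfolding mat_act_scale by simp
    then have "1 \<le> norm_sq n (\<lambda>i. x i + (- 1 * x i))"
      using that unfolding U_def by blast
    then show False by (simp add: norm_sq_def)
  qed
  obtain \<delta> where \<delta>: "\<delta> > 0" "\<And>x. x \<in> U \<Longrightarrow> \<delta> \<le> norm_sq n (mat_act n M x)"
  proof (cases "U = {}")
    case True
    then show ?thesis using that[of 1] by simp
  next
    case False
    have "continuous_on U (\<lambda>x. norm_sq n (mat_act n M x))"
      by (intro continuous_intros)
    from continuous_attains_inf[OF \<open>compact U\<close> False this]
    show ?thesis using that pos by blast
  qed
  show ?thesis
  proof (rule that[OF \<delta>(1)])
    fix x :: "nat \<Rightarrow> complex"
    let ?x = "\<lambda>i. if i < n then x i else 0"
    \<comment> \<open>Only preimages no longer than the truncation \<open>?x\<close> compete; this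
      makes the set compact, so a shortest one exists.\<close>
    define F where "F = {y :: nat \<Rightarrow> complex. (\<forall>i\<ge>n. y i = 0) \<and> norm_sq n y \<le> norm_sq n ?x} \<inter>
      {y. mat_act n M y = mat_act n M x}"
    have "compact F"
      unfolding F_def
      by (intro compact_Int_closed compact_norm_sq_le closed_Collect_eq continuous_intros)
    moreover have "?x \<in> F"
      by (auto simp: F_def mat_act_def cong: sum.cong_simp)
    moreover have "continuous_on F (norm_sq n)"
      by (intro continuous_intros)
    ultimately obtain y where y: "y \<in> F" and ymin: "\<And>z. z \<in> F \<Longrightarrow> norm_sq n y \<le> norm_sq n z"
      using continuous_attains_inf by (metis empty_iff)
    have My: "mat_act n M y = mat_act n M x" using y by (simp add: F_def)
    \<comment> \<open>Competitors longer than \<open>?x\<close> are longer than \<open>y\<close>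
      too, so \<open>y\<close> is minimal in its whole coset modulo the kernel.\<close>
    have min: "norm_sq n y \<le> norm_sq n (\<lambda>i. y i + z i)" if z: "mat_act n M z = (\<lambda>_. 0)" for z
    proof (cases "norm_sq n (\<lambda>i. y i + z i) \<le> norm_sq n ?x")
      case True
      let ?w = "\<lambda>i. if i < n then y i + z i else 0"
      have eq: "norm_sq n ?w = norm_sq n (\<lambda>i. y i + z i)"
        "mat_act n M ?w = mat_act n M (\<lambda>i. y i + z i)"
        by (auto simp: norm_sq_def mat_act_def cong: sum.cong_simp)
      have "?w \<in> F"
        unfolding F_def using True eq My z by (simp add: mat_act_add)
      then show ?thesis using ymin eq by metis
    next
      case False
      then show ?thesis using y by (simp add: F_def)
    qed
    have "\<delta> * norm_sq n y \<le> norm_sq n (mat_act n M y)"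
    proof (cases "norm_sq n y = 0")
      case True
      then show ?thesis by simp
    next
      case False
      define c where "c = complex_of_real (sqrt (norm_sq n y))"
      have c: "c \<noteq> 0" "(cmod c)\<^sup>2 = norm_sq n y"
        using False by (simp_all add: c_def)
      \<comment> \<open>The normalised \<open>y\<close> is still minimal in its coset and so lies in
        \<open>U\<close>; the bound there scales back to \<open>y\<close>.\<close>
      let ?u = "\<lambda>i. inverse c * y i"
      have "1 \<le> norm_sq n (\<lambda>i. ?u i + z i)" if z: "mat_act n M z = (\<lambda>_. 0)" for z
      proof -
        have "mat_act n M (\<lambda>i. c * z i) = (\<lambda>_. 0)" by (simp add: mat_act_scale z)
        from min[OF this] have "norm_sq n y \<le> norm_sq n (\<lambda>i. c * (?u i + z i))"
          using c(1) by (simp add: distrib_left flip: mult.assoc)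
        then have "norm_sq n y * 1 \<le> norm_sq n y * norm_sq n (\<lambda>i. ?u i + z i)"
          by (simp add: norm_sq_scale c(2))
        then show ?thesis
          using False norm_sq_nonneg[of n y] by (simp add: mult_le_cancel_left1)
      qed
      moreover have "norm_sq n ?u = 1"
        unfolding norm_sq_scale using False by (simp add: norm_inverse power_inverse c(2))
      ultimately have "?u \<in> U"
        using y by (auto simp: U_def F_def)
      then have "\<delta> \<le> inverse (norm_sq n y) * norm_sq n (mat_act n M y)"
        using \<delta>(2)[of ?u] by (simp add: mat_act_scale norm_sq_scale norm_inverse power_inverse c(2))
      then show ?thesis
        using False norm_sq_nonneg[of n y] by (simp add: field_simps)
    qed
    then show "\<exists>y. mat_act n M y = mat_act n M x \<and> \<delta> * norm_sq n y \<le> norm_sq n (mat_act n M x)"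
      using My by auto
  qed
qed

subsection \<open>Extreme points of level one\<close>

text \<open>The form at \<open>x\<close> depends only on \<open>M x\<close>, so \<open>x\<close> may be replaced by a bounded preimage of \<open>M x\<close>.\<close>

lemma hermitian_form_bounded_by_image:
  assumes "self_adjoint n M"
  obtains K where "K > 0" "\<And>x. \<bar>Re (sesq n M x x)\<bar> \<le> K * norm_sq n (mat_act n M x)"
proof -
  obtain \<delta> where \<delta>: "\<delta> > 0"
    "\<And>x. \<exists>y. mat_act n M y = mat_act n M x \<and> \<delta> * norm_sq n y \<le> norm_sq n (mat_act n M x)"
    using bounded_preimage[where n = n and M = M] by metis
  define C where "C = 1 + (\<Sum>i<n. \<Sum>k<n. cmod (index_mat M (i, k)))"
  have C: "C > 0" unfolding C_def by (intro add_pos_nonneg sum_nonneg) auto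
  show ?thesis
  proof (rule that)
    show "C / \<delta> > 0" using C \<delta>(1) by simp
    fix x
    obtain y where y: "mat_act n M y = mat_act n M x" "\<delta> * norm_sq n y \<le> norm_sq n (mat_act n M x)"
      using \<delta>(2) by blast
    have "sesq n M x x = sesq n M y x" by (simp add: sesq_mat_act y(1))
    also have "\<dots> = cnj (sesq n M x y)" by (rule sesq_cnj[OF assms])
    also have "sesq n M x y = sesq n M y y" by (simp add: sesq_mat_act y(1))
    finally have "\<bar>Re (sesq n M x x)\<bar> \<le> cmod (sesq n M y y)"
      using abs_Re_le_cmod[of "sesq n M y y"] by simp
    also have "\<dots> \<le> (\<Sum>i<n. \<Sum>k<n. cmod (index_mat M (i, k))) * norm_sq n y"
      by (rule sesq_bounded)
    also have "\<dots> \<le> C * norm_sq n y"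
      by (simp add: C_def distrib_right)
    also have "\<dots> = C / \<delta> * (\<delta> * norm_sq n y)"
      using \<delta>(1) by simp
    also have "\<dots> \<le> C / \<delta> * norm_sq n (mat_act n M x)"
      using y(2) C \<delta>(1) by (intro mult_left_mono) auto
    finally show "\<bar>Re (sesq n M x x)\<bar> \<le> C / \<delta> * norm_sq n (mat_act n M x)" .
  qed
qed

text \<open>With \<open>M = \<Sum>j. \<eta>_j A_j\<close>, \<open>pos\<close> is positivity of the
  block matrix with diagonal \<open>L_A(a)\<close>, \<open>L_A(\<gamma>)\<close> and off-diagonal
  blocks \<open>- M\<close>. It bounds \<open>|M x|^2\<close>, hence
  \<open>|\<langle>M x, x\<rangle>|\<close>, by a multiple of the form of \<open>L_A(a)\<close>, so
  \<open>a\<close> could move both ways along \<open>\<eta>\<close>.\<close>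

lemma extreme_point_tangent_zero:
  fixes A :: "'g::finite mat_tuple" and a \<eta> \<gamma> :: "real ^ 'g"
  assumes A: "A \<in> sa_tuples d"
    and ext: "a extreme_point_of level_one (free_spectrahedron d A)"
    and pos: "\<And>x y. 2 * (\<Sum>j\<in>UNIV. vec_nth \<eta> j * Re (sesq d (A j) x y)) \<le>
      (norm_sq d x - inner a (num_point d A x)) + (norm_sq d y - inner \<gamma> (num_point d A y))"
  shows "\<eta> = 0"
proof -
  define M where "M = mat d d (\<lambda>(i, k). \<Sum>j\<in>UNIV. of_real (vec_nth \<eta> j) * index_mat (A j) (i, k))"
  have M: "self_adjoint d M"
    unfolding self_adjoint_iff
  proof (intro conjI allI impI)
    fix i k assume "i < d" "k < d"
    moreover from this have "index_mat (A j) (k, i) = cnj (index_mat (A j) (i, k))" for j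
      using A unfolding sa_tuples_iff by blast
    ultimately show "index_mat M (k, i) = cnj (index_mat M (i, k))"
      by (simp add: M_def)
  qed (simp add: M_def)
  have sesqM: "sesq d M x y = (\<Sum>j\<in>UNIV. of_real (vec_nth \<eta> j) * sesq d (A j) x y)" for x y
  proof -
    have "sesq d M x y = (\<Sum>i<d. \<Sum>k<d. \<Sum>j\<in>UNIV.
        of_real (vec_nth \<eta> j) * index_mat (A j) (i, k) * x k * cnj (y i))"
      by (simp add: sesq_def M_def sum_distrib_right cong: sum.cong_simp)
    also have "\<dots> = (\<Sum>j\<in>UNIV. \<Sum>i<d. \<Sum>k<d.
        of_real (vec_nth \<eta> j) * index_mat (A j) (i, k) * x k * cnj (y i))"
      by (simp only: sum.swap[of _ "UNIV :: 'g set"])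
    finally show ?thesis
      by (simp add: sesq_def sum_distrib_left sum_distrib_right mult.assoc)
  qed
  have inner_\<eta>: "inner \<eta> (num_point d A x) = Re (sesq d M x x)" for x
    by (simp add: sesqM inner_vec_def num_point_def)
  obtain C0 where C0: "C0 > 0" "\<And>u. norm (num_point d A u) \<le> C0 * norm_sq d u"
    using num_point_bounded by blast
  \<comment> \<open>\<open>C\<close> bounds the form at \<open>\<gamma>\<close>: 1 for the identity,
    \<open>norm \<gamma> * C0\<close> for the linear part by Cauchy-Schwarz.\<close>
  define C where "C = 1 + norm \<gamma> * C0"
  have C: "C > 0" using C0(1) by (simp add: C_def add_pos_nonneg)
  have Q: "norm_sq d y - inner \<gamma> (num_point d A y) \<le> C * norm_sq d y" for y
  proof -
    have "- inner \<gamma> (num_point d A y) \<le> norm \<gamma> * norm (num_point d A y)"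
      using Cauchy_Schwarz_ineq2[of \<gamma> "num_point d A y"] by linarith
    also have "\<dots> \<le> norm \<gamma> * (C0 * norm_sq d y)"
      by (intro mult_left_mono C0) simp
    finally show ?thesis by (simp add: C_def algebra_simps)
  qed
  have image_le: "norm_sq d (mat_act d M x) \<le> C * (norm_sq d x - inner a (num_point d A x))" for x
  proof -
    let ?N = "norm_sq d (mat_act d M x)" and ?P = "norm_sq d x - inner a (num_point d A x)"
    \<comment> \<open>This \<open>y\<close> maximises
      \<open>2 Re \<langle>M x, y\<rangle> - C |y|^2\<close>; the maximum is
      \<open>|M x|^2 / C\<close>.\<close>
    let ?y = "\<lambda>i. of_real (1 / C) * mat_act d M x i"
    have "sesq d M x ?y = of_real (?N / C)"
      by (simp add: sesq_mat_act norm_sq_def sum_divide_distrib flip: complex_norm_square)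
    then have "(\<Sum>j\<in>UNIV. vec_nth \<eta> j * Re (sesq d (A j) x ?y)) = ?N / C"
      using arg_cong[OF sesqM[of x ?y], of Re] by simp
    with pos[of x ?y] Q[of ?y] have "2 * (?N / C) \<le> ?P + C * norm_sq d ?y"
      by linarith
    also have "C * norm_sq d ?y = ?N / C"
      unfolding norm_sq_scale using C by (simp add: power2_eq_square norm_divide)
    finally have "?N / C \<le> ?P" by linarith
    then show ?thesis using C by (simp add: pos_divide_le_eq mult.commute)
  qed
  obtain K where K: "K > 0" "\<And>x. \<bar>Re (sesq d M x x)\<bar> \<le> K * norm_sq d (mat_act d M x)"
    using hermitian_form_bounded_by_image[OF M] by blast
  \<comment> \<open>\<open>K * C\<close> is the combined constant of the two bounds, so a step of
    this length stays in level one.\<close>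
  define t where "t = 1 / (K * C)"
  have t: "t > 0" using K(1) C by (simp add: t_def)
  have "\<bar>t * inner \<eta> (num_point d A x)\<bar> \<le> norm_sq d x - inner a (num_point d A x)" for x
  proof -
    have "\<bar>inner \<eta> (num_point d A x)\<bar> \<le> K * (C * (norm_sq d x - inner a (num_point d A x)))"
      unfolding inner_\<eta> using K(1)
      by (intro order.trans[OF K(2)] mult_left_mono image_le) simp
    then show ?thesis
      using K(1) C by (simp add: t_def abs_mult pos_divide_le_eq mult_ac)
  qed
  then have bound: "t * inner \<eta> (num_point d A x) \<le> norm_sq d x - inner a (num_point d A x)"
    "- (t * inner \<eta> (num_point d A x)) \<le> norm_sq d x - inner a (num_point d A x)" for x
    by (simp_all add: abs_le_iff)
  have "a - t *\<^sub>R \<eta> \<in> level_one (free_spectrahedron d A)"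
    "a + t *\<^sub>R \<eta> \<in> level_one (free_spectrahedron d A)"
    unfolding level_one_iff[OF A] inner_add_left inner_diff_left inner_scaleR_left
    using bound by (simp_all add: algebra_simps)
  then have "a \<notin> open_segment (a - t *\<^sub>R \<eta>) (a + t *\<^sub>R \<eta>)"
    using ext by (auto simp: extreme_point_of_def)
  \<comment> \<open>If the two ends differed, their midpoint \<open>a\<close> would lie in the open
    segment, against extremality.\<close>
  moreover have "midpoint (a - t *\<^sub>R \<eta>) (a + t *\<^sub>R \<eta>) = a"
    by (simp add: midpoint_def scaleR_2[symmetric])
  ultimately have "a - t *\<^sub>R \<eta> = a + t *\<^sub>R \<eta>"
    by (metis midpoint_in_open_segment)
  then have "(2 * t) *\<^sub>R \<eta> = 0"
    by (simp add: scaleR_2 flip: scaleR_scaleR)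
  then show ?thesis using t by simp
qed

section \<open>Compressions and the second level\<close>

lemma sesq_one: "sesq n (1\<^sub>m n) x y = (\<Sum>i<n. x i * cnj (y i))"
proof -
  have "(\<Sum>k<n. index_mat (1\<^sub>m n) (i, k) * x k) = x i" if "i < n" for i
  proof -
    have "index_mat (1\<^sub>m n) (i, k) * x k = (if k = i then x k else 0)" if "k < n" for k
      using that \<open>i < n\<close> by simp
    then show ?thesis using that by (simp cong: sum.cong_simp)
  qed
  then show ?thesis by (simp add: sesq_def cong: sum.cong_simp)
qed

lemma norm_sq_conv_sesq: "complex_of_real (norm_sq n x) = sesq n (1\<^sub>m n) x x"
  by (simp add: sesq_one norm_sq_def flip: complex_norm_square)

text \<open>The \<open>w s\<close> are the columns of an isometry \<open>V\<close>, and the new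
  tuple is \<open>V^H X V\<close>, where \<open>V^H\<close> is the adjoint. Its form at
  \<open>v\<close> is the form of \<open>X\<close> at the vector whose blocks are \<open>V\<close>
  applied to those of \<open>v\<close>.\<close>

lemma compress_mem_free_spectrahedron:
  fixes A X :: "'g::finite mat_tuple" and w :: "nat \<Rightarrow> nat \<Rightarrow> complex"
  assumes A: "A \<in> sa_tuples d" and X: "X \<in> free_spectrahedron d A n"
    and orth: "\<And>s t. s < m \<Longrightarrow> t < m \<Longrightarrow> (\<Sum>p<n. w s p * cnj (w t p)) = (if s = t then 1 else 0)"
  shows "(\<lambda>j. mat m m (\<lambda>(s, t). sesq n (X j) (w t) (w s))) \<in> free_spectrahedron d A m"
proof -
  let ?Y = "\<lambda>j. mat m m (\<lambda>(s, t). sesq n (X j) (w t) (w s))"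
  have Xsa: "X \<in> sa_tuples n" and Xpos: "\<And>v. 0 \<le> pencil_form d n A X v"
    using X by (auto simp: free_spectrahedron_iff[OF A])
  have "?Y \<in> sa_tuples m"
    unfolding sa_tuples_iff
  proof (intro allI conjI impI)
    fix j i k assume "i < m" "k < m"
    moreover have "sesq n (X j) (w i) (w k) = cnj (sesq n (X j) (w k) (w i))"
      using Xsa by (intro sesq_cnj) (simp add: sa_tuples_def)
    ultimately show "index_mat (?Y j) (k, i) = cnj (index_mat (?Y j) (i, k))" by simp
  qed simp
  moreover have "0 \<le> pencil_form d m A ?Y v" for v
  proof -
    let ?v = "\<lambda>i p. \<Sum>s<m. v i s * w s p"
    have "norm_sq n (?v i) = norm_sq m (v i)" for i
    proof -
      have "complex_of_real (norm_sq n (?v i)) =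
          (\<Sum>t<m. \<Sum>s<m. if t = s then v i t * cnj (v i s) else 0)"
        unfolding norm_sq_conv_sesq sesq_sum
        by (simp add: sesq_one orth if_distrib cong: sum.cong_simp if_cong)
      also have "\<dots> = complex_of_real (norm_sq m (v i))"
        by (simp add: norm_sq_def flip: complex_norm_square)
      finally show ?thesis by (simp only: of_real_eq_iff)
    qed
    moreover have "sesq n (X j) (?v k) (?v i) = sesq m (?Y j) (v k) (v i)" for i j k
    proof -
      have "sesq n (X j) (?v k) (?v i) =
          (\<Sum>s<m. \<Sum>t<m. v k t * cnj (v i s) * sesq n (X j) (w t) (w s))"
        unfolding sesq_sum by (rule sum.swap)
      also have "\<dots> = sesq m (?Y j) (v k) (v i)"
        by (simp add: sesq_def[of m] sum_distrib_left sum_distrib_right mult_ac cong: sum.cong_simp)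
      finally show ?thesis .
    qed
    ultimately have "pencil_form d m A ?Y v = pencil_form d n A X ?v"
      by (simp add: pencil_form_def)
    then show ?thesis using Xpos by simp
  qed
  ultimately show ?thesis by (simp add: free_spectrahedron_iff[OF A])
qed

text \<open>After the flip the form is read at two blocks \<open>x\<close> and \<open>y\<close> of
  length \<open>d\<close>. The two off-diagonal terms are conjugate and add up to twice a real
  part.\<close>

lemma free_spectrahedron_level_two:
  fixes A Y :: "'g::finite mat_tuple"
  assumes A: "A \<in> sa_tuples d" and Y: "Y \<in> free_spectrahedron d A 2"
  shows "2 * (\<Sum>j\<in>UNIV. Re (index_mat (Y j) (1, 0) * sesq d (A j) x y)) \<le>
    (norm_sq d x - inner (\<chi> j. Re (index_mat (Y j) (0, 0))) (num_point d A x)) +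
    (norm_sq d y - inner (\<chi> j. Re (index_mat (Y j) (1, 1))) (num_point d A y))"
proof -
  have Ysa: "Y \<in> sa_tuples 2" and Ypos: "\<And>v. 0 \<le> pencil_form d 2 A Y v"
    using Y by (auto simp: free_spectrahedron_iff[OF A])
  have Yjs: "index_mat (Y j) (t, s) = cnj (index_mat (Y j) (s, t))" if "s < 2" "t < 2" for j s t
    using Ysa that unfolding sa_tuples_iff by blast
  have diag: "Im (index_mat (Y j) (s, s)) = 0" if "s < 2" for j s
    using Yjs[OF that that, of j] by (simp add: complex_eq_iff)
  have Asa: "self_adjoint d (A j)" for j using A by (simp add: sa_tuples_def)
  let ?v = "\<lambda>s::nat. if s = 0 then x else y"
  have term_eq: "Re (\<Sum>s<2. \<Sum>t<2. index_mat (Y j) (s, t) * sesq d (A j) (?v t) (?v s)) =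
      Re (index_mat (Y j) (0, 0)) * Re (sesq d (A j) x x) +
      Re (index_mat (Y j) (1, 1)) * Re (sesq d (A j) y y) +
      2 * Re (index_mat (Y j) (1, 0) * sesq d (A j) x y)" for j
  proof -
    have "index_mat (Y j) (0, 1) * sesq d (A j) y x = cnj (index_mat (Y j) (1, 0) * sesq d (A j) x y)"
      using Yjs[of 1 0 j] sesq_cnj[OF Asa, of j y x] by simp
    then have "Re (index_mat (Y j) (0, 1) * sesq d (A j) y x) = Re (index_mat (Y j) (1, 0) * sesq d (A j) x y)"
      by (simp only: cnj.sel)
    then show ?thesis
      using diag[of 0 j] diag[of 1 j] by (simp add: numeral_2_eq_2)
  qed
  have "0 \<le> pencil_form d 2 A Y (\<lambda>i s. ?v s i)" by (rule Ypos)
  also have "\<dots> = pencil_form 2 d Y A ?v"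
    by (rule pencil_form_flip[symmetric])
  also have "\<dots> = norm_sq d x + norm_sq d y - (\<Sum>j\<in>UNIV.
      Re (\<Sum>s<2. \<Sum>t<2. index_mat (Y j) (s, t) * sesq d (A j) (?v t) (?v s)))"
    by (simp add: pencil_form_def numeral_2_eq_2)
  also have "\<dots> = norm_sq d x + norm_sq d y -
      (inner (\<chi> j. Re (index_mat (Y j) (0, 0))) (num_point d A x) +
       inner (\<chi> j. Re (index_mat (Y j) (1, 1))) (num_point d A y) +
       2 * (\<Sum>j\<in>UNIV. Re (index_mat (Y j) (1, 0) * sesq d (A j) x y)))"
    unfolding term_eq by (simp add: sum.distrib inner_vec_def num_point_def sum_distrib_left)
  finally show ?thesis by simp
qed

text \<open>Otherwise the residual \<open>r\<close> of \<open>B j u\<close> orthogonal to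
  \<open>u\<close> is nonzero. Compressing to \<open>u\<close> and the normalised residual gives an
  off-diagonal entry \<open>|r|\<close>, while extremality forces all off-diagonal entries to
  vanish.\<close>

lemma extreme_point_joint_eigenvector:
  fixes A B :: "'g::finite mat_tuple"
  assumes A: "A \<in> sa_tuples d"
    and conj: "conj_tuple ` free_spectrahedron d A 2 \<subseteq> free_spectrahedron d A 2"
    and B: "B \<in> free_spectrahedron d A n" and u: "norm_sq n u = 1"
    and ext: "num_point n B u extreme_point_of level_one (free_spectrahedron d A)"
    and i: "i < n"
  shows "mat_act n (B j) u i = of_real (vec_nth (num_point n B u) j) * u i"
proof (rule ccontr)
  assume neq: "mat_act n (B j) u i \<noteq> of_real (vec_nth (num_point n B u) j) * u i"
  define a where "a = num_point n B u"
  define r where "r = (\<lambda>p. mat_act n (B j) u p - of_real (vec_nth a j) * u p)"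
  define c where "c = sqrt (norm_sq n r)"
  define w where "w = (\<lambda>p. of_real (inverse c) * r p)"
  have Bsa: "self_adjoint n (B j)" for j
    using B by (simp add: free_spectrahedron_iff[OF A] sa_tuples_def)
  have "norm_sq n r \<noteq> 0"
    using neq i by (auto simp: norm_sq_eq_0_iff r_def a_def)
  then have c: "c > 0" "c\<^sup>2 = norm_sq n r"
    using norm_sq_nonneg[of n r] by (simp_all add: c_def less_le)
  have uu: "(\<Sum>p<n. u p * cnj (u p)) = 1"
    using u by (metis norm_sq_conv_sesq sesq_one of_real_1)
  have "norm_sq n w = 1"
    unfolding w_def norm_sq_scale using c \<open>norm_sq n r \<noteq> 0\<close>
    by (simp add: norm_inverse power_inverse)
  then have ww: "(\<Sum>p<n. w p * cnj (w p)) = 1"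
    by (metis norm_sq_conv_sesq sesq_one of_real_1)
  have "(\<Sum>p<n. r p * cnj (u p)) = sesq n (B j) u u - of_real (vec_nth a j) * (\<Sum>p<n. u p * cnj (u p))"
    by (simp add: r_def sesq_mat_act left_diff_distrib sum_subtractf sum_distrib_left mult.assoc)
  also have "\<dots> = 0"
    using sesq_real[OF Bsa, of j u] by (simp add: uu a_def num_point_def)
  finally have ru: "(\<Sum>p<n. r p * cnj (u p)) = 0" .
  then have wu: "(\<Sum>p<n. w p * cnj (u p)) = 0"
    by (simp add: w_def mult.assoc flip: sum_distrib_left)
  then have uw: "(\<Sum>p<n. u p * cnj (w p)) = 0"
  proof -
    have "(\<Sum>p<n. u p * cnj (w p)) = cnj (\<Sum>p<n. w p * cnj (u p))"
      by (simp add: mult.commute)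
    then show ?thesis by (simp add: wu)
  qed

  let ?w = "\<lambda>s::nat. if s = 0 then u else w"
  define Y where "Y = (\<lambda>j. mat 2 2 (\<lambda>(s, t). sesq n (B j) (?w t) (?w s)))"
  have Y: "Y \<in> free_spectrahedron d A 2"
    unfolding Y_def
    by (rule compress_mem_free_spectrahedron[OF A B]) (auto simp: uu ww uw wu less_2_cases_iff)
  then have Y': "conj_tuple Y \<in> free_spectrahedron d A 2"
    using conj by blast
  define \<beta> where "\<beta> = (\<lambda>j. sesq n (B j) u w)"
  define \<gamma> where "\<gamma> = num_point n B w"
  have Y_entries: "(\<chi> j. Re (index_mat (Y j) (0, 0))) = a" "(\<chi> j. Re (index_mat (Y j) (1, 1))) = \<gamma>"
    "index_mat (Y j) (1, 0) = \<beta> j" for j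
    by (simp_all add: Y_def a_def \<beta>_def \<gamma>_def num_point_def)
  have Y'_entries: "(\<chi> j. Re (index_mat (conj_tuple Y j) (0, 0))) = a"
    "(\<chi> j. Re (index_mat (conj_tuple Y j) (1, 1))) = \<gamma>"
    "index_mat (conj_tuple Y j) (1, 0) = cnj (\<beta> j)" for j
    by (simp_all add: conj_tuple_def Y_def a_def \<beta>_def \<gamma>_def num_point_def)
  let ?P = "\<lambda>x. norm_sq d x - inner a (num_point d A x)"
  let ?Q = "\<lambda>y. norm_sq d y - inner \<gamma> (num_point d A y)"
  have ineq: "2 * (\<Sum>j\<in>UNIV. Re (\<beta> j * sesq d (A j) x y)) \<le> ?P x + ?Q y"
    "2 * (\<Sum>j\<in>UNIV. Re (cnj (\<beta> j) * sesq d (A j) x y)) \<le> ?P x + ?Q y" for x y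
    using free_spectrahedron_level_two[OF A Y, of x y] free_spectrahedron_level_two[OF A Y', of x y]
    unfolding Y_entries Y'_entries by auto
  have Q_unit: "?Q (\<lambda>i. b * y i) = ?Q y" if "cmod b = 1" for b y
    using that by (simp add: norm_sq_scale num_point_scale)
  have sesq_unit: "sesq d (A j) x (\<lambda>i. b * y i) = cnj b * sesq d (A j) x y" for j x b y
    using sesq_scale[of d "A j" 1 x b y] by simp
  \<comment> \<open>Adding the inequalities for \<open>Y\<close> and its conjugate leaves the real
    part of \<open>\<beta>\<close>.\<close>
  have "(\<chi> j. Re (\<beta> j)) = 0"
  proof (rule extreme_point_tangent_zero[OF A])
    show "a extreme_point_of level_one (free_spectrahedron d A)"
      using ext by (simp add: a_def)
    fix x y
    have "(\<Sum>j\<in>UNIV. Re (\<beta> j * sesq d (A j) x y)) + (\<Sum>j\<in>UNIV. Re (cnj (\<beta> j) * sesq d (A j) x y)) =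
        2 * (\<Sum>j\<in>UNIV. Re (\<beta> j) * Re (sesq d (A j) x y))"
      unfolding sum.distrib[symmetric] sum_distrib_left by (rule sum.cong) simp_all
    then show "2 * (\<Sum>j\<in>UNIV. vec_nth (\<chi> j. Re (\<beta> j)) j * Re (sesq d (A j) x y)) \<le> ?P x + ?Q y"
      using ineq[of x y] by simp
  qed
  \<comment> \<open>Putting \<open>\<i> y\<close> into the first inequality and
    \<open>- \<i> y\<close> into the second turns \<open>\<beta>\<close> and its conjugate into
    \<open>- \<i> \<beta>\<close> and \<open>\<i> cnj \<beta>\<close>, whose sum is
    \<open>2 Im \<beta>\<close>. Unit factors do not change \<open>?Q\<close>.\<close>
  moreover have "(\<chi> j. Im (\<beta> j)) = 0"
  proof (rule extreme_point_tangent_zero[OF A])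
    show "a extreme_point_of level_one (free_spectrahedron d A)"
      using ext by (simp add: a_def)
    fix x y
    have "(\<Sum>j\<in>UNIV. Re (\<beta> j * sesq d (A j) x (\<lambda>i. \<i> * y i))) +
        (\<Sum>j\<in>UNIV. Re (cnj (\<beta> j) * sesq d (A j) x (\<lambda>i. - \<i> * y i))) =
        2 * (\<Sum>j\<in>UNIV. Im (\<beta> j) * Re (sesq d (A j) x y))"
      unfolding sesq_unit sum.distrib[symmetric] sum_distrib_left
      by (rule sum.cong) (simp_all add: algebra_simps)
    then show "2 * (\<Sum>j\<in>UNIV. vec_nth (\<chi> j. Im (\<beta> j)) j * Re (sesq d (A j) x y)) \<le> ?P x + ?Q y"
      using ineq(1)[of x "\<lambda>i. \<i> * y i"] ineq(2)[of x "\<lambda>i. - \<i> * y i"]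
        Q_unit[of \<i> y] Q_unit[of "- \<i>" y] by simp
  qed
  ultimately have "\<beta> j = 0"
    by (metis complex_eq_iff vec_lambda_beta zero_complex.sel zero_index)
  \<comment> \<open>Here \<open>B j u = r + a_j u\<close> and \<open>w\<close> is orthogonal to
    \<open>u\<close>, so only \<open>\<langle>r, w\<rangle> = |r|\<close> survives.\<close>
  moreover have "\<beta> j = of_real c"
  proof -
    have "\<beta> j = (\<Sum>p<n. (r p + of_real (vec_nth a j) * u p) * cnj (w p))"
      by (simp add: \<beta>_def sesq_mat_act r_def)
    also have "\<dots> = (\<Sum>p<n. r p * cnj (w p)) + of_real (vec_nth a j) * (\<Sum>p<n. u p * cnj (w p))"
      by (simp add: distrib_right sum.distrib sum_distrib_left mult.assoc)
    also have "\<dots> = of_real (inverse c) * (\<Sum>p<n. r p * cnj (r p))"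
      unfolding uw by (simp add: w_def sum_distrib_left mult_ac)
    also have "(\<Sum>p<n. r p * cnj (r p)) = of_real (c\<^sup>2)"
      unfolding c(2) by (simp add: norm_sq_conv_sesq sesq_one)
    also have "of_real (inverse c) * of_real (c\<^sup>2) = (of_real c :: complex)"
      using c(1) by (simp add: power2_eq_square)
    finally show ?thesis .
  qed
  ultimately show False using c(1) by simp
qed

section \<open>Finiteness of the joint eigenvalues\<close>

lemma finite_vec_set:
  fixes F :: "'g::finite \<Rightarrow> 'a set"
  assumes "\<And>j. finite (F j)"
  shows "finite {a :: 'a ^ 'g. \<forall>j. vec_nth a j \<in> F j}"
proof -
  have "{a :: 'a ^ 'g. \<forall>j. vec_nth a j \<in> F j} \<subseteq> vec_lambda ` PiE UNIV F"
  proof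
    fix a :: "'a ^ 'g" assume "a \<in> {a. \<forall>j. vec_nth a j \<in> F j}"
    then have "vec_nth a \<in> PiE UNIV F" by auto
    then show "a \<in> vec_lambda ` PiE UNIV F"
      by (metis image_eqI vec_nth_inverse)
  qed
  then show ?thesis
    using assms by (meson finite_PiE finite_class.finite_UNIV finite_imageI finite_subset)
qed

text \<open>Coordinate \<open>j\<close> is an eigenvalue of \<open>B j\<close>, so the points lie in
  a finite product of finite spectra.\<close>

lemma finite_joint_eigenvalues:
  fixes B :: "'g::finite mat_tuple"
  assumes B: "B \<in> sa_tuples n"
  shows "finite {a :: real ^ 'g. \<exists>u. norm_sq n u = 1 \<and>
    (\<forall>j. \<forall>i<n. mat_act n (B j) u i = of_real (vec_nth a j) * u i)}"
proof (rule finite_subset)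
  let ?F = "\<lambda>j. {t :: real. complex_of_real t \<in> spectrum (B j)}"
  have Bc: "B j \<in> carrier_mat n n" for j
    using B by (simp add: sa_tuples_iff)
  have "finite (?F j)" for j
  proof -
    have "finite (complex_of_real -` spectrum (B j))"
      using card_finite_spectrum(1)[OF Bc] by (intro finite_vimageI) (auto simp: inj_on_def)
    then show ?thesis by (simp add: vimage_def)
  qed
  then show "finite {a :: real ^ 'g. \<forall>j. vec_nth a j \<in> ?F j}"
    by (rule finite_vec_set)
  show "{a :: real ^ 'g. \<exists>u. norm_sq n u = 1 \<and>
    (\<forall>j. \<forall>i<n. mat_act n (B j) u i = of_real (vec_nth a j) * u i)} \<subseteq> {a. \<forall>j. vec_nth a j \<in> ?F j}"
  proof clarify
    fix a :: "real ^ 'g" and u j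
    assume u: "norm_sq n u = 1"
      and eig: "\<forall>j. \<forall>i<n. mat_act n (B j) u i = of_real (vec_nth a j) * u i"
    let ?u = "Matrix.vec n u"
    have "eigenvector (B j) ?u (of_real (vec_nth a j))"
      unfolding eigenvector_def
    proof (intro conjI)
      show "?u \<in> carrier_vec (dim_row (B j))" using Bc[of j] by simp
      have "\<not> (\<forall>i<n. u i = 0)"
        using u norm_sq_eq_0_iff[of n u] by simp
      then show "?u \<noteq> 0\<^sub>v (dim_row (B j))"
        using Bc[of j] by (auto simp: vec_eq_iff)
      have "vec_index (B j *\<^sub>v ?u) i = mat_act n (B j) u i" if "i < n" for i
        using Bc[of j] that by (simp add: mat_act_def scalar_prod_def atLeast0LessThan)
      then show "B j *\<^sub>v ?u = of_real (vec_nth a j) \<cdot>\<^sub>v ?u"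
        using Bc[of j] eig by (intro eq_vecI) auto
    qed
    then show "complex_of_real (vec_nth a j) \<in> spectrum (B j)"
      by (auto simp: spectrum_def eigenvalue_def)
  qed
qed

section \<open>The polar dual and the hull of the numerical range\<close>

lemma polar_dual_free_spectrahedron_iff:
  assumes A: "A \<in> sa_tuples d"
  shows "B \<in> polar_dual (free_spectrahedron d A) n \<longleftrightarrow> B \<in> sa_tuples n \<and>
    (\<forall>m>0. \<forall>X\<in>free_spectrahedron d A m. \<forall>v. 0 \<le> pencil_form n m B X v)"
proof -
  have "X \<in> sa_tuples m" if "X \<in> free_spectrahedron d A m" for X m
    using that by (simp add: free_spectrahedron_def)
  then show ?thesis
    by (auto simp: polar_dual_def psd_linear_pencil_iff)
qed

text \<open>\<open>A\<close> lies in its own polar dual by definition. At the positive level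
  \<open>d\<close> the assumed equality makes this positivity of \<open>L_B(A)\<close>, and the flip
  gives that of \<open>L_A(B)\<close>.\<close>

lemma coefficients_of_dual_mem:
  fixes A B :: "'g::finite mat_tuple"
  assumes d: "d > 0" and A: "A \<in> sa_tuples d" and B: "B \<in> sa_tuples n"
    and dual: "\<And>m. m > 0 \<Longrightarrow> polar_dual (free_spectrahedron d A) m = free_spectrahedron n B m"
  shows "B \<in> free_spectrahedron d A n"
proof -
  have "A \<in> polar_dual (free_spectrahedron d A) d"
    by (auto simp: polar_dual_free_spectrahedron_iff[OF A] free_spectrahedron_iff[OF A] A)
  then have "0 \<le> pencil_form n d B A v" for v
    using d dual by (simp add: free_spectrahedron_iff[OF B])
  then show ?thesis
    using B by (simp add: free_spectrahedron_iff[OF A] flip: pencil_form_flip[of d n])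
qed

text \<open>Homogeneity extends a bound from unit vectors to all vectors; at norm zero, where
  normalising fails, both sides vanish.\<close>

lemma inner_num_point_le:
  assumes "\<And>w. w \<in> numerical_range n B \<Longrightarrow> inner c w \<le> M"
  shows "inner c (num_point n B u) \<le> M * norm_sq n u"
proof (cases "norm_sq n u = 0")
  case True
  then have "num_point n B u = 0"
    by (simp add: norm_sq_eq_0_iff num_point_def sesq_def Finite_Cartesian_Product.vec_eq_iff)
  then show ?thesis using True by simp
next
  case False
  define s where "s = sqrt (norm_sq n u)"
  have s: "s \<noteq> 0" "s\<^sup>2 = norm_sq n u"
    using False by (simp_all add: s_def)
  let ?u = "\<lambda>i. of_real (inverse s) * u i"
  have "norm_sq n ?u = 1"
    unfolding norm_sq_scale using s False by (simp add: norm_inverse power_inverse)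
  then have "inner c (num_point n B ?u) \<le> M"
    by (intro assms) (auto simp: numerical_range_def)
  then have "inverse (norm_sq n u) * inner c (num_point n B u) \<le> M"
    by (simp add: num_point_scale norm_inverse power_inverse s(2))
  then show ?thesis
    using False norm_sq_nonneg[of n u] by (simp add: field_simps)
qed

text \<open>The hull lies in level one because \<open>B\<close> lies in the spectrahedron of
  \<open>A\<close>. A point outside the hull would be cut off by a functional that, suitably scaled,
  belongs to the dual at level one, where values are at most 1.\<close>

lemma level_one_eq_hull_numerical_range:
  fixes A B :: "'g::finite mat_tuple"
  assumes d: "d > 0" and A: "A \<in> sa_tuples d" and n: "n > 0" and B: "B \<in> sa_tuples n"
    and dual: "\<And>m. m > 0 \<Longrightarrow> polar_dual (free_spectrahedron d A) m = free_spectrahedron n B m"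
  shows "level_one (free_spectrahedron d A) = convex hull (numerical_range n B)"
proof
  have "B \<in> free_spectrahedron d A n"
    by (rule coefficients_of_dual_mem[OF d A B dual])
  then show "convex hull (numerical_range n B) \<subseteq> level_one (free_spectrahedron d A)"
    by (intro hull_minimal convex_level_one[OF A])
       (auto simp: numerical_range_def intro: num_point_mem_level_one[OF A])
  \<comment> \<open>Such a \<open>c\<close> lies in level one of the spectrahedron of
    \<open>B\<close>, hence in the dual; the pencil at two scalar tuples is the number
    \<open>1 - inner c z\<close>.\<close>
  have scalar_dual: "inner c z \<le> 1"
    if c: "\<And>u. inner c (num_point n B u) \<le> norm_sq n u"
      and z: "z \<in> level_one (free_spectrahedron d A)" for c z :: "real ^ 'g"
  proof -
    have "scalar_tuple c \<in> free_spectrahedron n B 1"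
      using c level_one_iff[OF B, of c] by (simp add: level_one_def)
    then have "scalar_tuple c \<in> polar_dual (free_spectrahedron d A) 1"
      using dual[of 1] by simp
    then have pos: "\<forall>m>0. \<forall>X\<in>free_spectrahedron d A m. \<forall>v. 0 \<le> pencil_form 1 m (scalar_tuple c) X v"
      unfolding polar_dual_free_spectrahedron_iff[OF A] by (rule conjunct2)
    have "scalar_tuple z \<in> free_spectrahedron d A 1"
      using z by (simp add: level_one_def)
    then have "0 \<le> pencil_form 1 1 (scalar_tuple c) (scalar_tuple z) (\<lambda>_ _. 1)"
      by (rule pos[rule_format, rotated]) simp
    then show ?thesis
      unfolding pencil_form_scalar[OF scalar_tuple_sa] num_point_scalar_tuple
      by (simp add: norm_sq_def inner_commute)
  qed
  show "level_one (free_spectrahedron d A) \<subseteq> convex hull (numerical_range n B)"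
  proof (rule subsetI, rule ccontr)
    fix z assume z: "z \<in> level_one (free_spectrahedron d A)" "z \<notin> convex hull (numerical_range n B)"
    have "compact (convex hull (numerical_range n B))"
      by (intro compact_convex_hull compact_numerical_range)
    from separating_hyperplane_closed_point[OF convex_convex_hull compact_imp_closed[OF this] z(2)]
    obtain c0 M0 where sep0: "inner c0 z < M0" "\<And>w. w \<in> convex hull (numerical_range n B) \<Longrightarrow> M0 < inner c0 w"
      by blast
    \<comment> \<open>Signs are reversed so that the numerical range lies below \<open>M\<close> and
      \<open>z\<close> above.\<close>
    define c M where "c = - c0" and "M = - M0"
    have cz: "M < inner c z" and cN: "inner c w < M" if "w \<in> numerical_range n B" for w
      using sep0 hull_inc[OF that] by (auto simp: c_def M_def)
    \<comment> \<open>The first basis vector exists as \<open>n > 0\<close>. It shows that the range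
      is nonempty, which both \<open>cz\<close> and \<open>cN\<close> presuppose.\<close>
    let ?e = "\<lambda>i::nat. if i = 0 then 1 else (0::complex)"
    have "norm_sq n ?e = 1"
    proof -
      have "norm_sq n ?e = (\<Sum>i<n. if i = 0 then 1 else 0)"
        unfolding norm_sq_def by (rule sum.cong) auto
      then show ?thesis using n by simp
    qed
    then have nonempty: "num_point n B ?e \<in> numerical_range n B"
      by (auto simp: numerical_range_def)
    have cu: "inner c (num_point n B u) \<le> M * norm_sq n u" for u
      by (rule inner_num_point_le) (use cN in force)
    show False
    proof (cases "M > 0")
      case True
      have "inner (inverse M *\<^sub>R c) z \<le> 1"
        using cu True by (intro scalar_dual z) (simp add: field_simps)
      then show False using cz[OF nonempty] True by (simp add: field_simps)
    next
      case False
      \<comment> \<open>Now \<open>\<D>\<^sub>B(1)\<close> contains the ray through \<open>c\<close>, but it is bounded because \<open>0\<close> is interior to \<open>\<D>\<^sub>A(1)\<close>.\<close>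
      obtain C where C: "C > 0" "\<And>u. norm (num_point d A u) \<le> C * norm_sq d u"
        using num_point_bounded by blast
      have "c \<noteq> 0" using cz[OF nonempty] cN[OF nonempty] by auto
      \<comment> \<open>Scaled to norm \<open>1 / C\<close>, short enough for level one.\<close>
      define x where "x = (1 / (C * norm c)) *\<^sub>R c"
      have "x \<in> level_one (free_spectrahedron d A)"
        unfolding level_one_iff[OF A]
      proof
        fix u
        have "inner x (num_point d A u) \<le> norm x * norm (num_point d A u)"
          by (rule norm_cauchy_schwarz)
        also have "\<dots> \<le> norm x * (C * norm_sq d u)"
          by (intro mult_left_mono C) simp
        also have "\<dots> = norm_sq d u"
          using C(1) \<open>c \<noteq> 0\<close> by (simp add: x_def)
        finally show "inner x (num_point d A u) \<le> norm_sq d u" .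
      qed
      \<comment> \<open>The factor is chosen so that the pairing with \<open>x\<close> equals 2,
        against the bound 1.\<close>
      moreover have "inner ((2 * C / norm c) *\<^sub>R c) (num_point n B u) \<le> norm_sq n u" for u
      proof -
        have "M * norm_sq n u \<le> 0"
          using False by (intro mult_nonpos_nonneg) auto
        then have "inner c (num_point n B u) \<le> 0" using cu[of u] by linarith
        then have "(2 * C / norm c) * inner c (num_point n B u) \<le> 0"
          using C(1) by (intro mult_nonneg_nonpos) auto
        then show ?thesis using norm_sq_nonneg[of n u] by (simp only: inner_scaleR_left)
      qed
      ultimately have "inner ((2 * C / norm c) *\<^sub>R c) x \<le> 1"
        by (intro scalar_dual)
      then show False
        using C(1) \<open>c \<noteq> 0\<close> by (simp add: x_def power2_eq_square flip: power2_norm_eq_inner)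
    qed
  qed
qed

text \<open>A compact convex set is the hull of its extreme points. Here these lie in the numerical
  range of \<open>B\<close> and are joint eigenvalues, so there are finitely many.\<close>

lemma polyhedron_level_one:
  fixes A :: "'g::finite mat_tuple"
  assumes d: "d > 0" and A: "A \<in> sa_tuples d"
    and conj: "conj_tuple ` free_spectrahedron d A 2 \<subseteq> free_spectrahedron d A 2"
    and dual: "is_free_spectrahedron (polar_dual (free_spectrahedron d A))"
  shows "polyhedron (level_one (free_spectrahedron d A))"
proof -
  obtain n B where n: "n > 0" and B: "B \<in> sa_tuples n"
    and eq: "\<And>m. m > 0 \<Longrightarrow> polar_dual (free_spectrahedron d A) m = free_spectrahedron n B m"
    using dual by (auto simp: is_free_spectrahedron_def)
  let ?K = "level_one (free_spectrahedron d A)"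
  have hull: "?K = convex hull (numerical_range n B)"
    by (rule level_one_eq_hull_numerical_range[OF d A n B eq])
  have BA: "B \<in> free_spectrahedron d A n"
    by (rule coefficients_of_dual_mem[OF d A B eq])
  have "finite {a. a extreme_point_of ?K}"
  proof (rule finite_subset[OF _ finite_joint_eigenvalues[OF B]], clarify)
    fix a assume ext: "a extreme_point_of ?K"
    then have "a \<in> numerical_range n B"
      unfolding hull by (rule extreme_point_of_convex_hull)
    then obtain u where u: "norm_sq n u = 1" and a: "a = num_point n B u"
      by (auto simp: numerical_range_def)
    show "\<exists>u. norm_sq n u = 1 \<and> (\<forall>j. \<forall>i<n. mat_act n (B j) u i = of_real (vec_nth a j) * u i)"
      using extreme_point_joint_eigenvector[OF A conj BA u] u ext unfolding a by blast
  qed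
  moreover have "?K = convex hull {a. a extreme_point_of ?K}"
    unfolding hull
    by (intro Krein_Milman_Minkowski compact_convex_hull compact_numerical_range convex_convex_hull)
  ultimately show ?thesis
    by (metis polytope_def polytope_imp_polyhedron)
qed

section \<open>Balls are not polyhedra\<close>

text \<open>Inside a segment the distance to \<open>c\<close> is strictly below that of one end, so
  it cannot equal \<open>r\<close> when both ends lie in the ball.\<close>

lemma extreme_point_of_cball_sphere:
  fixes x c :: "'a::euclidean_space"
  assumes "x \<in> sphere c r"
  shows "x extreme_point_of cball c r"
proof -
  have False if ab: "a \<in> cball c r" "b \<in> cball c r" and x: "x \<in> open_segment a b" for a b
    using dist_decreases_open_segment[OF x, of c] ab assms by (force simp: dist_commute)
  with assms show ?thesis by (auto simp: extreme_point_of_def)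
qed

text \<open>A polyhedron has finitely many extreme points, so the sphere would be finite. From
  dimension two on it is connected, hence at most one point, yet it contains antipodal
  points.\<close>

lemma not_polyhedron_cball:
  fixes c :: "'a::euclidean_space"
  assumes "r > 0" "DIM('a) \<ge> 2"
  shows "\<not> polyhedron (cball c r)"
proof
  assume "polyhedron (cball c r)"
  then have "finite (sphere c r)"
    using finite_polyhedron_extreme_points
    by (metis (no_types, lifting) extreme_point_of_cball_sphere finite_subset mem_Collect_eq subsetI)
  moreover have "connected (sphere c r)"
    using assms by (simp add: connected_sphere_eq)
  ultimately have single: "sphere c r = {} \<or> (\<exists>p. sphere c r = {p})"
    using connected_finite_iff_sing by metis
  obtain e :: 'a where e: "norm e = 1" using vector_choose_size[of 1] by auto
  have "c + r *\<^sub>R e \<in> sphere c r" "c - r *\<^sub>R e \<in> sphere c r"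
    using assms e by (simp_all add: dist_norm)
  then have "c + r *\<^sub>R e = c - r *\<^sub>R e" using single by (metis emptyE singletonD)
  moreover have "(c + r *\<^sub>R e) - (c - r *\<^sub>R e) = (2 * r) *\<^sub>R e"
    by (simp add: scaleR_2 flip: scaleR_scaleR)
  ultimately have "(2 * r) *\<^sub>R e = 0" by simp
  then show False using assms e by auto
qed

text \<open>In one variable a ball is an interval, and at radius 0 it is a point; both are
  polyhedra, whence \<open>CARD('g) \<ge> 2\<close> and \<open>r > 0\<close> in the second
  part.\<close>

theorem corollary1p3:
  fixes A :: "'g::finite mat_tuple" and d :: nat
  assumes "d > 0" and "A \<in> sa_tuples d"
    and "free_spectrahedron d A 2 = conj_tuple ` free_spectrahedron d A 2"
  shows "(is_free_spectrahedron (polar_dual (free_spectrahedron d A)) \<longrightarrow>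
            polyhedron (level_one (free_spectrahedron d A))) \<and>
         (CARD('g) \<ge> 2 \<longrightarrow>
            (\<exists>c r. r > 0 \<and> level_one (free_spectrahedron d A) = cball c r) \<longrightarrow>
            \<not> is_free_spectrahedron (polar_dual (free_spectrahedron d A)))"
proof -
  have "conj_tuple ` free_spectrahedron d A 2 \<subseteq> free_spectrahedron d A 2"
    using assms(3) by simp
  from polyhedron_level_one[OF assms(1,2) this]
  have poly: "polyhedron (level_one (free_spectrahedron d A))"
    if "is_free_spectrahedron (polar_dual (free_spectrahedron d A))"
    using that .
  have "\<not> is_free_spectrahedron (polar_dual (free_spectrahedron d A))"
    if "CARD('g) \<ge> 2" "r > 0" "level_one (free_spectrahedron d A) = cball c r" for c r
    using poly not_polyhedron_cball[of r c] that by auto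
  with poly show ?thesis by blast
qed

end
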